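(* Let $A$ and $B$ be strings of length $n\ge 1$ over $\{\mathrm{H},\mathrm{T}\}$ that are the same except for the last letter, i.e. $A_i=B_i$ for $1\le i\le n-1$ and $A_n\neq B_n$. In the No-Flippancy game with Alice's string $A$ and Bob's string $B$, if $n$ is even then Bob wins, and if $n$ is odd then Alice wins.
   Context: No-Flippancy game: Alice and Bob have distinct strings $A=A_1\cdots A_n$ and $B=B_1\cdots B_n$ of the same length $n$ over the alphabet $\{\mathrm{H},\mathrm{T}\}$. Starting from the empty sequence, the players alternate turns, Alice going first, and on each turn the current player appends one letter to the sequence (the game output) as follows: let $i<n$ be the maximal length of a suffix of the current sequence that coincides with a prefix of the current player's string ($i=0$ is allowed, via the empty suffix); the player appends the letter with index $i+1$ of their own string. The game ends as soon as $A$ or $B$ appears as a block of consecutive letters in the sequence (necessarily as its suffix, no matter who made the last move); the player whose string appears first wins. If neither string ever appears, the game is infinite. *)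

theory Defs
  imports Main "HOL-Library.Sublist"
begin

datatype letter = H | T

(* Length of the longest suffix of the sequence s that is a proper prefix of the string P
   (meaningful for nonempty P, where 0 always qualifies). *)
definition overlap :: "letter list \<Rightarrow> letter list \<Rightarrow> nat" where
  "overlap P s = Max {i. i < length P \<and> suffix (take i P) s}"

(* List indices start at 0, so this is the letter with index (overlap P s) + 1 of P
   when letters are counted from 1. *)
definition next_letter :: "letter list \<Rightarrow> letter list \<Rightarrow> letter" where
  "next_letter P s = P ! overlap P s"

definition game_over :: "letter list \<Rightarrow> letter list \<Rightarrow> letter list \<Rightarrow> bool" where
  "game_over A B s \<longleftrightarrow> sublist A s \<or> sublist B s"

(* The sequence after k turns, or the final sequence if the game has ended before. Alice
   makes the moves after an even number of turns, Bob those after an odd number. *)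
primrec game_seq :: "letter list \<Rightarrow> letter list \<Rightarrow> nat \<Rightarrow> letter list" where
  "game_seq A B 0 = []"
| "game_seq A B (Suc k) =
    (let s = game_seq A B k in
     if game_over A B s then s
     else s @ [next_letter (if even k then A else B) s])"

definition alice_wins :: "letter list \<Rightarrow> letter list \<Rightarrow> bool" where
  "alice_wins A B \<longleftrightarrow>
    (\<exists>k. sublist A (game_seq A B k) \<and> (\<forall>j\<le>k. \<not> sublist B (game_seq A B j)))"

definition bob_wins :: "letter list \<Rightarrow> letter list \<Rightarrow> bool" where
  "bob_wins A B \<longleftrightarrow>
    (\<exists>k. sublist B (game_seq A B k) \<and> (\<forall>j\<le>k. \<not> sublist A (game_seq A B j)))"

end

theory Submission
  imports Defs
begin

text \<open>Both players have the same proper prefixes, so the output simply spells out the common prefix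
  of length \<open>n - 1\<close>; whoever makes the \<open>n\<close>-th move completes their own string.\<close>

text \<open>The sequence \<open>take k P\<close> is itself a proper prefix of \<open>P\<close>, so
  \<open>k\<close> is attained, and no suffix of the sequence is longer than
  \<open>k\<close>.\<close>

lemma overlap_take:
  assumes "k < length P"
  shows "overlap P (take k P) = k"
  unfolding overlap_def
proof (rule Max_eqI)
  show "finite {i. i < length P \<and> suffix (take i P) (take k P)}"
    by simp
  show "k \<in> {i. i < length P \<and> suffix (take i P) (take k P)}"
    using assms by simp
next
  fix i assume "i \<in> {i. i < length P \<and> suffix (take i P) (take k P)}"
  then show "i \<le> k"
    using suffix_length_le[of "take i P" "take k P"] assms by simp
qed

lemma next_letter_take:
  assumes "k < length P"
  shows "take k P @ [next_letter P (take k P)] = take (Suc k) P"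
  using assms by (simp add: next_letter_def overlap_take take_Suc_conv_app_nth)

lemma not_sublist_shorter: "length s < length P \<Longrightarrow> \<not> sublist P s"
  using sublist_length_le by fastforce

lemma sublist_same_length_eq: "sublist xs ys \<Longrightarrow> length xs = length ys \<Longrightarrow> xs = ys"
  by (auto simp: sublist_def)

lemma take_eq_of_common_prefix:
  assumes "length A = length B" "\<forall>i < m. A ! i = B ! i" "k \<le> m" "m \<le> length A"
  shows "take k A = take k B"
  using assms by (intro nth_equalityI) auto

text \<open>For \<open>k > 0\<close>, the parity of \<open>k\<close> tells who moved last. While
  \<open>k \<le> m\<close> both choices give the same list; at \<open>k = Suc m\<close> the mover's
  own letter decides, which is why the bound goes one past the common prefix.\<close>

lemma game_seq_common_prefix:
  assumes len: "length A = length B" and "m < length A"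
    and common: "\<forall>i < m. A ! i = B ! i"
    and "k \<le> Suc m"
  shows "game_seq A B k = take k (if even k then B else A)"
  using \<open>k \<le> Suc m\<close>
proof (induction k)
  case 0
  show ?case by simp
next
  case (Suc k)
  let ?P = "if even k then A else B"
  \<comment> \<open>The induction hypothesis gives a prefix of the last mover's string; as
    \<open>k \<le> m\<close>, it is also a prefix of \<open>?P\<close>, the string of the player to
    move.\<close>
  have "take k A = take k B"
    using Suc.prems assms by (intro take_eq_of_common_prefix[of A B m]) auto
  then have s: "game_seq A B k = take k ?P"
    using Suc by auto
  have k: "k < length ?P"
    using Suc.prems assms by auto
  then have "\<not> game_over A B (take k ?P)"
    unfolding game_over_def using len by (auto intro!: not_sublist_shorter split: if_splits)
  then have "game_seq A B (Suc k) = take k ?P @ [next_letter ?P (take k ?P)]"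
    by (simp add: s Let_def)
  also have "\<dots> = take (Suc k) ?P"
    using k by (rule next_letter_take)
  finally show ?case by simp
qed

theorem lemma16:
  fixes A B :: "letter list" and n :: nat
  assumes "n \<ge> 1"
    and "length A = n" and "length B = n"
    and "\<forall>i < n - 1. A ! i = B ! i"
    and "A ! (n - 1) \<noteq> B ! (n - 1)"
  shows "(even n \<longrightarrow> bob_wins A B) \<and> (odd n \<longrightarrow> alice_wins A B)"
proof -
  have seq: "game_seq A B k = take k (if even k then B else A)" if "k \<le> n" for k
    using that assms by (intro game_seq_common_prefix[of A B "n - 1"]) auto
  have final: "game_seq A B n = (if even n then B else A)"
    using seq[of n] assms by simp
  have early: "\<not> sublist A (game_seq A B j)" "\<not> sublist B (game_seq A B j)" if "j < n" for j
    using that assms by (auto simp: seq intro!: not_sublist_shorter)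
  \<comment> \<open>This covers the stage \<open>j = n\<close>, which \<open>early\<close> leaves
    out: by equal lengths, containment would force \<open>A = B\<close>, against the differing last
    letters. The witness for either win is then \<open>k = n\<close>.\<close>
  have "\<not> sublist A B" "\<not> sublist B A"
    using assms(2,3,5) sublist_same_length_eq by metis+
  then show ?thesis
    unfolding alice_wins_def bob_wins_def
    using final early by (metis le_neq_implies_less sublist_order.order_refl)
qed

end
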